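(* Let $N\ge 3$, let $v_a,v_b$ with $1\le a<b\le N$ be two distinct rim vertices of the wheel graph $W_{N+1}$ with central vertex $c$, and let $d=b-a$, so that the two cyclic intervals determined by $\{v_a,v_b\}$ are $d$ and $N-d$. Then $$\mathcal F_{W_{N+1}}(\{c,v_a,v_b\})=\tau(W_{N+1}/\{c,v_a,v_b\})=F_{2d}F_{2(N-d)}.$$
   Context: The wheel graph $W_{N+1}$ ($N\ge3$) has vertex set $\{c,v_1,\ldots,v_N\}$ and edges $\{v_i,v_{i+1}\}$ (indices modulo $N$) and $\{c,v_i\}$ for $1\le i\le N$; $c$ is the central vertex and the $v_i$ are the rim vertices. For a finite connected graph $G$ and $\varnothing\ne S\subseteq V(G)$, a rooted spanning forest of $G$ with root set $S$ is a spanning forest (an acyclic subgraph containing all vertices of $G$) in which each connected component contains exactly one vertex of $S$; $\mathcal F_G(S)$ denotes the number of such forests. $G/S$ is the multigraph obtained from $G$ by identifying all vertices of $S$ into a single vertex, keeping multiple edges with their multiplicities and deleting loops. $\tau(H)$ is the number of spanning trees of $H$, where parallel edges are regarded as distinct. Fibonacci numbers: $F_0=0$, $F_1=1$, $F_{n+2}=F_{n+1}+F_n$. *)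

theory Defs
  imports "HOL-Number_Theory.Fib"
begin

text \<open>
  Finite undirected multigraphs with named edges, so parallel edges are distinct objects. An edge
  has a set of one (loop) or two endpoints.
\<close>

record ('v, 'e) multigraph =
  verts :: "'v set"
  edges :: "'e set"
  ends :: "'e \<Rightarrow> 'v set"

definition wf_multigraph :: "('v, 'e) multigraph \<Rightarrow> bool" where
  "wf_multigraph G \<longleftrightarrow> finite (verts G) \<and> finite (edges G) \<and>
     (\<forall>e\<in>edges G. ends G e \<subseteq> verts G \<and> card (ends G e) \<in> {1, 2})"

text \<open>
  The endpoint function is required to agree everywhere, not only on the edges of the subgraph,
  so that a subgraph is determined by its vertices and edges.
\<close>

definition subgraph :: "('v, 'e) multigraph \<Rightarrow> ('v, 'e) multigraph \<Rightarrow> bool" where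
  "subgraph H G \<longleftrightarrow> verts H \<subseteq> verts G \<and> edges H \<subseteq> edges G \<and> ends H = ends G \<and>
     (\<forall>e\<in>edges H. ends H e \<subseteq> verts H)"

definition spanning :: "('v, 'e) multigraph \<Rightarrow> ('v, 'e) multigraph \<Rightarrow> bool" where
  "spanning H G \<longleftrightarrow> subgraph H G \<and> verts H = verts G"

definition adj :: "('v, 'e) multigraph \<Rightarrow> ('v \<times> 'v) set" where
  "adj G = {(u, v). \<exists>e\<in>edges G. ends G e = {u, v}}"

definition component :: "('v, 'e) multigraph \<Rightarrow> 'v \<Rightarrow> 'v set" where
  "component G v = {w \<in> verts G. (v, w) \<in> (adj G)\<^sup>*}"

definition components :: "('v, 'e) multigraph \<Rightarrow> 'v set set" where
  "components G = component G ` verts G"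

definition connected_graph :: "('v, 'e) multigraph \<Rightarrow> bool" where
  "connected_graph G \<longleftrightarrow>
     verts G \<noteq> {} \<and> (\<forall>u\<in>verts G. \<forall>v\<in>verts G. (u, v) \<in> (adj G)\<^sup>*)"

text \<open>
  A cycle visits the distinct vertices \<open>vs\<close> along the distinct edges \<open>es\<close>. Length 1 is a loop,
  length 2 a pair of parallel edges.
\<close>

definition is_cycle :: "('v, 'e) multigraph \<Rightarrow> 'v list \<Rightarrow> 'e list \<Rightarrow> bool" where
  "is_cycle G vs es \<longleftrightarrow>
     vs \<noteq> [] \<and> length es = length vs \<and> distinct vs \<and> distinct es \<and>
     set vs \<subseteq> verts G \<and> set es \<subseteq> edges G \<and>
     (\<forall>i < length vs. ends G (es ! i) = {vs ! i, vs ! (Suc i mod length vs)})"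

definition forest :: "('v, 'e) multigraph \<Rightarrow> bool" where
  "forest G \<longleftrightarrow> \<not> (\<exists>vs es. is_cycle G vs es)"

definition spanning_trees :: "('v, 'e) multigraph \<Rightarrow> ('v, 'e) multigraph set" where
  "spanning_trees G = {T. spanning T G \<and> connected_graph T \<and> forest T}"

definition num_spanning_trees :: "('v, 'e) multigraph \<Rightarrow> nat" where
  "num_spanning_trees G = card (spanning_trees G)"

definition rooted_spanning_forests ::
    "('v, 'e) multigraph \<Rightarrow> 'v set \<Rightarrow> ('v, 'e) multigraph set" where
  "rooted_spanning_forests G S =
     {H. spanning H G \<and> forest H \<and> (\<forall>C\<in>components H. \<exists>!s. s \<in> C \<and> s \<in> S)}"

definition num_rooted_spanning_forests :: "('v, 'e) multigraph \<Rightarrow> 'v set \<Rightarrow> nat" where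
  "num_rooted_spanning_forests G S = card (rooted_spanning_forests G S)"

text \<open>
  The quotient of \<open>G\<close> by \<open>S\<close>: its vertices are the classes of the partition of the vertex set
  whose blocks are \<open>S\<close> and the singletons outside \<open>S\<close>. Edges keep their names, hence their
  multiplicities, except those that become loops, which are deleted.
\<close>

definition vertex_class :: "'v set \<Rightarrow> 'v \<Rightarrow> 'v set" where
  "vertex_class S v = (if v \<in> S then S else {v})"

definition contract :: "('v, 'e) multigraph \<Rightarrow> 'v set \<Rightarrow> ('v set, 'e) multigraph" where
  "contract G S =
     \<lparr>verts = vertex_class S ` verts G,
      edges = {e \<in> edges G. card (vertex_class S ` ends G e) \<noteq> 1},
      ends = (\<lambda>e. vertex_class S ` ends G e)\<rparr>"

datatype wheel_vertex = Center | Rim nat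

text \<open>
  The wheel with \<open>N\<close> rim vertices \<open>Rim 1, \<dots>, Rim N\<close>, intended for \<open>N \<ge> 3\<close>. It is a simple graph,
  so an edge is named by its set of endpoints; \<open>i mod N + 1\<close> is the cyclic successor of \<open>i\<close>
  in \<open>{1..N}\<close>.
\<close>

definition wheel :: "nat \<Rightarrow> (wheel_vertex, wheel_vertex set) multigraph" where
  "wheel N =
     \<lparr>verts = insert Center (Rim ` {1..N}),
      edges = (\<lambda>i. {Rim i, Rim (i mod N + 1)}) ` {1..N} \<union> (\<lambda>i. {Center, Rim i}) ` {1..N},
      ends = (\<lambda>e. e)\<rparr>"

lemma wf_multigraph_wheel: "wf_multigraph (wheel N)"
  by (auto simp: wf_multigraph_def wheel_def card_insert_if Suc_le_eq split: if_splits)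

lemma connected_graph_wheel: "connected_graph (wheel N)"
proof -
  have to: "(v, Center) \<in> (adj (wheel N))\<^sup>*" and "from": "(Center, v) \<in> (adj (wheel N))\<^sup>*"
    if "v \<in> verts (wheel N)" for v
  proof -
    have "v = Center \<or> (v, Center) \<in> adj (wheel N) \<and> (Center, v) \<in> adj (wheel N)"
      using that by (auto simp: adj_def wheel_def)
    then show "(v, Center) \<in> (adj (wheel N))\<^sup>*" "(Center, v) \<in> (adj (wheel N))\<^sup>*"
      by auto
  qed
  have "verts (wheel N) \<noteq> {}"
    by (simp add: wheel_def)
  with to "from" show ?thesis
    unfolding connected_graph_def by (meson rtrancl_trans)
qed

lemma wf_multigraph_contract:
  assumes "wf_multigraph G"
  shows "wf_multigraph (contract G S)"
proof -
  have "card (vertex_class S ` ends G e) \<in> {1, 2}" if "e \<in> edges G" for e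
  proof -
    have c: "card (ends G e) \<in> {1, 2}"
      using assms that by (auto simp: wf_multigraph_def)
    then have "finite (ends G e)" "ends G e \<noteq> {}"
      by (auto intro: card_ge_0_finite)
    then have "card (vertex_class S ` ends G e) \<le> card (ends G e)"
        "card (vertex_class S ` ends G e) \<noteq> 0"
      by (auto intro: card_image_le)
    with c show ?thesis by auto
  qed
  with assms show ?thesis
    by (auto simp: wf_multigraph_def contract_def)
qed

end

theory Submission
  imports Defs "HOL-Number_Theory.Cong"
begin

text \<open>
  Directing every edge of a rooted spanning forest towards its root identifies the forest with the
  map sending each non-root to its parent edge, and acyclicity becomes the existence of a rank that
  decreases along parents. Such maps are the same for \<open>(G, S)\<close> and for the quotient \<open>G/S\<close> rooted at
  the class of \<open>S\<close>, which gives the first equality. In the wheel with roots \<open>c, v\<^sub>a, v\<^sub>b\<close>, a non-root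
  rim vertex chooses its parent among the hub, its successor and its predecessor. As the rim is cut
  at two roots, the only obstruction to acyclicity is two neighbours choosing each other, so both
  numbers count pairs of words over three letters, of lengths \<open>d - 1\<close> and \<open>N - d - 1\<close>, avoiding one
  factor of length two; there are \<open>F\<^bsub>2n+2\<^esub>\<close> such words of length \<open>n\<close>.
\<close>

section \<open>Parent maps and the forests they generate\<close>

lemma wf_multigraph_endsE:
  assumes "wf_multigraph G" "e \<in> edges G"
  obtains x y where "ends G e = {x, y}" "x \<in> verts G" "y \<in> verts G"
proof -
  have V: "ends G e \<subseteq> verts G" and "card (ends G e) = 1 \<or> card (ends G e) = 2"
    using assms by (auto simp: wf_multigraph_def)
  then show ?thesis
  proof (elim disjE)
    assume "card (ends G e) = 1"
    then obtain x where "ends G e = {x}"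
      by (rule card_1_singletonE)
    then show ?thesis
      using that[of x x] V by simp
  next
    assume "card (ends G e) = 2"
    then obtain x y where "ends G e = {x, y}"
      by (auto simp: card_2_iff)
    then show ?thesis
      using that[of x y] V by simp
  qed
qed

text \<open>The rank \<open>r\<close> certifies acyclicity: it drops from each non-root to the other
  end of its parent edge, which also excludes loops.\<close>

definition parent_map ::
    "('v, 'e) multigraph \<Rightarrow> 'v set \<Rightarrow> ('v \<Rightarrow> 'e) \<Rightarrow> ('v \<Rightarrow> nat) \<Rightarrow> bool" where
  "parent_map G S p r \<longleftrightarrow>
     (\<forall>v\<in>verts G - S. p v \<in> edges G \<and> (\<exists>u. ends G (p v) = {v, u} \<and> r u < r v))"

text \<open>Only edge sets are kept: contraction preserves edge names, so the sets for
  \<open>G\<close> and for \<open>contract G S\<close> can be compared directly.\<close>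

definition rooted_edge_sets :: "('v, 'e) multigraph \<Rightarrow> 'v set \<Rightarrow> 'e set set" where
  "rooted_edge_sets G S = {X. \<exists>p r. parent_map G S p r \<and> X = p ` (verts G - S)}"

lemma parent_mapE:
  assumes "parent_map G S p r" "v \<in> verts G - S"
  obtains u where "p v \<in> edges G" "ends G (p v) = {v, u}" "r u < r v"
  using assms unfolding parent_map_def by blast

text \<open>Two vertices sharing a parent edge would be its two ends, each of smaller rank than the
  other.\<close>

lemma parent_map_inj_on:
  assumes "parent_map G S p r"
  shows "inj_on p (verts G - S)"
proof (rule inj_onI)
  fix v w assume v: "v \<in> verts G - S" and w: "w \<in> verts G - S" and eq: "p v = p w"
  obtain u where "ends G (p v) = {v, u}" "r u < r v"
    using parent_mapE[OF assms v] by metis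
  moreover obtain u' where "ends G (p w) = {w, u'}" "r u' < r w"
    using parent_mapE[OF assms w] by metis
  ultimately show "v = w"
    using eq by (auto simp: doubleton_eq_iff)
qed

text \<open>Induction on the rank \<open>r\<close> recovers the map from its edge set; the second
  map may have a different rank.\<close>

lemma parent_map_unique:
  assumes p: "parent_map G S p r" and p': "parent_map G S p' r'"
    and img: "p ` (verts G - S) = p' ` (verts G - S)"
    and "v \<in> verts G - S"
  shows "p v = p' v"
  using \<open>v \<in> verts G - S\<close>
proof (induction "r v" arbitrary: v rule: less_induct)
  case less
  obtain u where u: "ends G (p v) = {v, u}" "r u < r v"
    using parent_mapE[OF p less.prems] by metis
  obtain w where w: "w \<in> verts G - S" "p v = p' w"
    using img less.prems by blast
  obtain u' where u': "ends G (p' w) = {w, u'}"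
    using parent_mapE[OF p' w(1)] by metis
  show ?case
  proof (cases "w = v")
    \<comment> \<open>Here \<open>p v\<close> is the \<open>p'\<close>-parent edge of
      \<open>u\<close>, hence by induction its \<open>p\<close>-parent edge, against injectivity of
      \<open>p\<close>.\<close>
    case False
    then have "w = u"
      using u u' w by (auto simp: doubleton_eq_iff)
    then have "p w = p v"
      using less.hyps[of w] u w by simp
    then show ?thesis
      using inj_onD[OF parent_map_inj_on[OF p]] False w less.prems by blast
  qed (use w in simp)
qed

text \<open>At a vertex of maximal rank on a cycle, both incident cycle edges would have to be its
  parent edge.\<close>

lemma parent_map_forest:
  assumes p: "parent_map G S p r"
  shows "forest (G\<lparr>edges := p ` (verts G - S)\<rparr>)"
  unfolding forest_def
proof clarify
  fix vs es
  assume "is_cycle (G\<lparr>edges := p ` (verts G - S)\<rparr>) vs es"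
  then have cyc: "vs \<noteq> []" "length es = length vs" "distinct vs" "distinct es"
      "set es \<subseteq> p ` (verts G - S)"
      and ends: "\<And>i. i < length vs \<Longrightarrow> ends G (es ! i) = {vs ! i, vs ! (Suc i mod length vs)}"
    by (auto simp: is_cycle_def)
  let ?n = "length vs"
  have n: "?n > 0"
    using cyc by simp
  obtain i where i: "i < ?n" and max: "\<And>k. k < ?n \<Longrightarrow> r (vs ! k) \<le> r (vs ! i)"
  proof -
    have "finite (r ` set vs)" "r ` set vs \<noteq> {}"
      using cyc by auto
    then have "Max (r ` set vs) \<in> r ` set vs"
      by (rule Max_in)
    then obtain i where "i < ?n" "r (vs ! i) = Max (r ` set vs)"
      by (metis (mono_tags) image_iff in_set_conv_nth)
    then show ?thesis
      using that[of i] by simp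
  qed
  \<comment> \<open>If the edge were the parent edge of \<open>y\<close> instead,
    \<open>r (vs ! i) < r y\<close> would follow.\<close>
  have edge: "es ! k = p (vs ! i) \<and> y \<noteq> vs ! i"
    if k: "k < ?n" and e: "ends G (es ! k) = {vs ! i, y}" and y: "r y \<le> r (vs ! i)" for k y
  proof -
    have "es ! k \<in> p ` (verts G - S)"
      using cyc k by (metis nth_mem subsetD)
    then obtain v where v: "v \<in> verts G - S" "es ! k = p v"
      by blast
    then obtain u where u: "ends G (p v) = {v, u}" "r u < r v"
      using parent_mapE[OF p] by metis
    then show ?thesis
      using e y v by (auto simp: doubleton_eq_iff)
  qed
  define j where "j = (if i = 0 then ?n - 1 else i - 1)"
  have j: "j < ?n" "Suc j mod ?n = i"
    using i n by (auto simp: j_def)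
  have 1: "es ! i = p (vs ! i) \<and> vs ! (Suc i mod ?n) \<noteq> vs ! i"
    using edge[OF i ends[OF i] max] n by simp
  have 2: "es ! j = p (vs ! i) \<and> vs ! j \<noteq> vs ! i"
    using edge[OF j(1) _ max[OF j(1)]] ends[OF j(1)] j(2) by (simp add: insert_commute)
  \<comment> \<open>Distinctness of \<open>es\<close> turns the equal edges into
    \<open>i = j\<close>, contradicting \<open>vs ! j \<noteq> vs ! i\<close>. A loop, where
    \<open>i = j\<close> from the start, is covered too.\<close>
  show False
    using 1 2 cyc i j by (metis nth_eq_iff_index_eq)
qed

lemma parent_map_rooted_spanning_forest:
  assumes wf: "wf_multigraph G" and S: "S \<subseteq> verts G" and p: "parent_map G S p r"
  shows "G\<lparr>edges := p ` (verts G - S)\<rparr> \<in> rooted_spanning_forests G S"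
proof -
  let ?V = "verts G - S"
  let ?H = "G\<lparr>edges := p ` ?V\<rparr>"
  \<comment> \<open>\<open>P\<close> is single-valued and has no step out of \<open>S\<close>, so the vertices leading to a given root are
    closed under adjacency and contain no other root.\<close>
  define P where "P = {(v, u). v \<in> ?V \<and> ends G (p v) = {v, u}}"
  have sv: "single_valued P"
    by (auto simp: P_def single_valued_def doubleton_eq_iff)
  have P_adj: "P \<subseteq> adj ?H"
    by (auto simp: P_def adj_def)
  have sym: "sym (adj ?H)"
    by (auto simp: sym_def adj_def insert_commute)
  have adj_P: "(x, y) \<in> P \<or> (y, x) \<in> P" if xy: "(x, y) \<in> adj ?H" for x y
  proof -
    obtain v where v: "v \<in> ?V" "ends G (p v) = {x, y}"
      using xy by (auto simp: adj_def)
    moreover have "v = x \<or> v = y"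
      using parent_mapE[OF p v(1)] v(2) by blast
    ultimately show ?thesis
      by (auto simp: P_def insert_commute)
  qed
  have "\<exists>s\<in>S. (v, s) \<in> P\<^sup>*" if "v \<in> verts G" for v
    using that
  proof (induction "r v" arbitrary: v rule: less_induct)
    case less
    show ?case
    proof (cases "v \<in> S")
      case False
      with less.prems have v: "v \<in> ?V" by blast
      obtain u where u: "p v \<in> edges G" "ends G (p v) = {v, u}" "r u < r v"
        using parent_mapE[OF p v] by metis
      then have "u \<in> verts G"
        using wf by (auto simp: wf_multigraph_def)
      then obtain s where "s \<in> S" "(u, s) \<in> P\<^sup>*"
        using less.hyps u by blast
      moreover have "(v, u) \<in> P"
        using u v by (simp add: P_def)
      ultimately show ?thesis
        by (meson converse_rtrancl_into_rtrancl)
    qed auto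
  qed
  then have ex: "\<exists>s\<in>S. (v, s) \<in> (adj ?H)\<^sup>*" if "v \<in> verts G" for v
    using that rtrancl_mono[OF P_adj] by blast
  have "(t, s) \<in> P\<^sup>*" if "s \<in> S" "(s, t) \<in> (adj ?H)\<^sup>*" for s t
    using that(2)
  proof (induction rule: rtrancl_induct)
    case (step y z)
    from adj_P[OF step(2)] show ?case
    proof
      assume yz: "(y, z) \<in> P"
      \<comment> \<open>The path from \<open>y\<close> to \<open>s\<close> therefore has a first
        step, which by single-valuedness is the step to \<open>z\<close>.\<close>
      then have "y \<noteq> s"
        using \<open>s \<in> S\<close> by (auto simp: P_def)
      with step.IH obtain y' where "(y, y') \<in> P" "(y', s) \<in> P\<^sup>*"
        by (metis converse_rtranclE)
      then show ?thesis
        using sv yz by (metis single_valuedD)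
    qed (use step.IH in auto)
  qed simp
  then have uniq: "t = s" if "s \<in> S" "t \<in> S" "(s, t) \<in> (adj ?H)\<^sup>*" for s t
    using that by (auto elim!: converse_rtranclE[of t] simp: P_def)
  have "\<exists>!s. s \<in> component ?H v \<and> s \<in> S" if v: "v \<in> verts G" for v
  proof -
    obtain s where s: "s \<in> S" "(v, s) \<in> (adj ?H)\<^sup>*"
      using ex v by blast
    show ?thesis
    proof (rule ex1I[of _ s])
      show "s \<in> component ?H v \<and> s \<in> S"
        using s S by (auto simp: component_def)
    next
      fix t assume t: "t \<in> component ?H v \<and> t \<in> S"
      have "(s, v) \<in> (adj ?H)\<^sup>*"
        using s sym by (meson sym_rtrancl symD)
      then show "t = s"
        using uniq[of s t] s t by (auto simp: component_def dest: rtrancl_trans)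
    qed
  qed
  moreover have "spanning ?H G"
  proof -
    have "p ` ?V \<subseteq> edges G"
      using p by (auto simp: parent_map_def)
    then show ?thesis
      using wf by (auto simp: spanning_def subgraph_def wf_multigraph_def)
  qed
  ultimately show ?thesis
    using parent_map_forest[OF p]
    by (auto simp: rooted_spanning_forests_def components_def)
qed

section \<open>From a rooted forest back to a parent map\<close>

text \<open>The path grows one step at a time; when the new vertex was visited before, it is cut
  back to that visit.\<close>

lemma rtrancl_distinct_path:
  assumes "(x, y) \<in> R\<^sup>*"
  obtains vs where "vs \<noteq> []" "distinct vs" "hd vs = x" "last vs = y"
    "\<And>i. Suc i < length vs \<Longrightarrow> (vs ! i, vs ! Suc i) \<in> R"
proof -
  have "\<exists>vs. vs \<noteq> [] \<and> distinct vs \<and> hd vs = x \<and> last vs = y \<and>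
      (\<forall>i. Suc i < length vs \<longrightarrow> (vs ! i, vs ! Suc i) \<in> R)"
    using assms
  proof (induction rule: rtrancl_induct)
    case base
    show ?case
      by (intro exI[of _ "[x]"]) simp
  next
    case (step y z)
    then obtain vs where vs: "vs \<noteq> []" "distinct vs" "hd vs = x" "last vs = y"
        "\<And>i. Suc i < length vs \<Longrightarrow> (vs ! i, vs ! Suc i) \<in> R"
      by blast
    show ?case
    proof (cases "z \<in> set vs")
      case True
      then obtain k where k: "k < length vs" "vs ! k = z"
        by (metis in_set_conv_nth)
      have "last (take (Suc k) vs) = z"
        using k by (simp add: take_Suc_conv_app_nth)
      with vs show ?thesis
        by (intro exI[of _ "take (Suc k) vs"]) auto
    next
      case False
      have "(vs ! i, (vs @ [z]) ! Suc i) \<in> R" if "i < length vs" for i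
      proof (cases "Suc i = length vs")
        case True
        then have "vs ! i = y"
          using vs by (metis diff_Suc_1 last_conv_nth)
        with True step(2) show ?thesis
          by (simp add: nth_append)
      next
        case False
        then show ?thesis
          using vs(5) that by (simp add: nth_append)
      qed
      with vs False show ?thesis
        by (intro exI[of _ "vs @ [z]"]) (auto simp: nth_append)
    qed
  qed
  with that show ?thesis by blast
qed

text \<open>A simple path from \<open>x\<close> to \<open>y\<close> inside \<open>X\<close> is
  closed up by \<open>e\<close>. For \<open>x = y\<close> the path is a single vertex and
  \<open>e\<close> a loop.\<close>

lemma cycle_through_edge:
  assumes wf: "wf_multigraph H" and e: "e \<in> edges H" "ends H e = {x, y}" "e \<notin> X"
    and X: "X \<subseteq> edges H" and path: "(x, y) \<in> (adj (H\<lparr>edges := X\<rparr>))\<^sup>*"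
  shows "\<not> forest H"
proof -
  obtain vs where vs: "vs \<noteq> []" "distinct vs" "hd vs = x" "last vs = y"
      "\<And>i. Suc i < length vs \<Longrightarrow> (vs ! i, vs ! Suc i) \<in> adj (H\<lparr>edges := X\<rparr>)"
    using rtrancl_distinct_path[OF path] by metis
  define n where "n = length vs - 1"
  have len: "length vs = Suc n"
    using vs(1) by (simp add: n_def)
  have "\<forall>i<n. \<exists>f\<in>X. ends H f = {vs ! i, vs ! Suc i}"
    using vs(5) by (auto simp: adj_def len)
  then obtain f where f: "\<And>i. i < n \<Longrightarrow> f i \<in> X" "\<And>i. i < n \<Longrightarrow> ends H (f i) = {vs ! i, vs ! Suc i}"
    by metis
  have inj: "inj_on f {..<n}"
  proof (rule inj_onI)
    fix i j assume ij: "i \<in> {..<n}" "j \<in> {..<n}" "f i = f j"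
    then have "{vs ! i, vs ! Suc i} = {vs ! j, vs ! Suc j}"
      using f(2) by (metis lessThan_iff)
    then show "i = j"
      using ij vs(2) len by (auto simp: doubleton_eq_iff nth_eq_iff_index_eq)
  qed
  define es where "es = map f [0..<n] @ [e]"
  have xy: "vs ! 0 = x" "vs ! n = y"
    using vs len by (auto simp: hd_conv_nth last_conv_nth)
  have "is_cycle H vs es"
    unfolding is_cycle_def
  proof (intro conjI allI impI)
    show "length es = length vs"
      by (simp add: es_def len)
    show "distinct es"
      using inj f(1) e(3) by (auto simp: es_def distinct_map atLeast0LessThan)
    show "set es \<subseteq> edges H"
      using f(1) X e(1) by (auto simp: es_def)
    show "set vs \<subseteq> verts H"
    proof
      fix v assume "v \<in> set vs"
      then obtain i where i: "i < Suc n" "vs ! i = v"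
        using len by (metis in_set_conv_nth)
      have "\<exists>e\<in>edges H. v \<in> ends H e"
      proof (cases "i = n")
        case True
        then show ?thesis
          using e i xy by auto
      next
        case False
        then have "i < n" using i by simp
        then show ?thesis
          using f[of i] X i by auto
      qed
      then show "v \<in> verts H"
        using wf by (auto simp: wf_multigraph_def)
    qed
    fix i assume "i < length vs"
    then show "ends H (es ! i) = {vs ! i, vs ! (Suc i mod length vs)}"
      using f(2) e(2) xy by (cases "i = n") (auto simp: es_def nth_append len insert_commute)
  qed (use vs in auto)
  then show ?thesis
    by (auto simp: forest_def)
qed

lemma rooted_spanning_forest_parent_map:
  assumes wf: "wf_multigraph G" and H: "H \<in> rooted_spanning_forests G S"
  shows "edges H \<in> rooted_edge_sets G S"
proof -
  have sp: "verts H = verts G" "edges H \<subseteq> edges G" "ends H = ends G"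
    and fo: "forest H"
    and root: "\<And>v. v \<in> verts G \<Longrightarrow> \<exists>!s. s \<in> component H v \<and> s \<in> S"
    using H by (auto simp: rooted_spanning_forests_def spanning_def subgraph_def components_def)
  have wfH: "wf_multigraph H"
    using wf sp finite_subset[OF sp(2)] by (auto simp: wf_multigraph_def)
  have sym: "sym (adj H)"
    by (auto simp: sym_def adj_def insert_commute)
  \<comment> \<open>The rank is the distance to \<open>S\<close>. An edge that is nobody's parent edge would close a cycle,
    because its ends are already joined through their common root.\<close>
  define r where "r v = (LEAST n. \<exists>s\<in>S. (s, v) \<in> adj H ^^ n)" for v
  have "\<exists>e\<in>edges H. \<exists>u. ends H e = {v, u} \<and> r u < r v" if v: "v \<in> verts G - S" for v
  proof -
    obtain s where "s \<in> S" "(v, s) \<in> (adj H)\<^sup>*"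
      using root[of v] v unfolding component_def by blast
    then have "\<exists>n. \<exists>s\<in>S. (s, v) \<in> adj H ^^ n"
      using sym by (meson sym_rtrancl symD rtrancl_imp_relpow)
    then have "\<exists>s\<in>S. (s, v) \<in> adj H ^^ r v"
      unfolding r_def by (rule LeastI_ex)
    then obtain s where s: "s \<in> S" "(s, v) \<in> adj H ^^ r v"
      by blast
    then obtain m where m: "r v = Suc m"
      using v by (cases "r v") auto
    \<comment> \<open>Dropping the last edge of a shortest walk from \<open>S\<close> to
      \<open>v\<close> leaves a walk of length \<open>m\<close> to \<open>u\<close>.\<close>
    then obtain u where u: "(s, u) \<in> adj H ^^ m" "(u, v) \<in> adj H"
      using s by auto
    have "r u \<le> m"
      unfolding r_def using u(1) s(1) by (blast intro: Least_le)
    then show ?thesis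
      using u(2) m by (auto simp: adj_def insert_commute less_Suc_eq_le)
  qed
  then obtain p where p: "\<And>v. v \<in> verts G - S \<Longrightarrow> p v \<in> edges H"
      "\<And>v. v \<in> verts G - S \<Longrightarrow> \<exists>u. ends H (p v) = {v, u} \<and> r u < r v"
    by metis
  let ?X = "p ` (verts G - S)"
  let ?H = "G\<lparr>edges := ?X\<rparr>"
  have pm: "parent_map G S p r"
    using p sp by (auto simp: parent_map_def)
  have XH: "?X \<subseteq> edges H"
    using p by blast
  have HH: "?H = H\<lparr>edges := ?X\<rparr>"
    using sp by simp
  have adjm: "adj ?H \<subseteq> adj H"
    using XH sp by (auto simp: adj_def)
  have "edges H \<subseteq> ?X"
  proof (rule ccontr)
    assume "\<not> edges H \<subseteq> ?X"
    then obtain e where e: "e \<in> edges H" "e \<notin> ?X"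
      by blast
    obtain x y where xy: "ends H e = {x, y}" "x \<in> verts G" "y \<in> verts G"
      using wf_multigraph_endsE[OF wfH e(1)] sp by metis
    \<comment> \<open>\<open>S\<close> may reach outside \<open>verts G\<close> here, so the
      previous construction is applied to \<open>S \<inter> verts G\<close>, which leaves the same
      non-roots.\<close>
    have red: "\<exists>s\<in>S \<inter> verts G. (v, s) \<in> (adj ?H)\<^sup>*" if "v \<in> verts G" for v
    proof -
      have "parent_map G (S \<inter> verts G) p r"
        using pm by (auto simp: parent_map_def)
      then have "G\<lparr>edges := p ` (verts G - S \<inter> verts G)\<rparr> \<in> rooted_spanning_forests G (S \<inter> verts G)"
        by (rule parent_map_rooted_spanning_forest[OF wf Int_lower2])
      moreover have "verts G - S \<inter> verts G = verts G - S"
        by blast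
      ultimately have "?H \<in> rooted_spanning_forests G (S \<inter> verts G)"
        by simp
      then show ?thesis
        using that by (fastforce simp: rooted_spanning_forests_def components_def component_def)
    qed
    obtain s t where s: "s \<in> S \<inter> verts G" "(x, s) \<in> (adj ?H)\<^sup>*"
      and t: "t \<in> S \<inter> verts G" "(y, t) \<in> (adj ?H)\<^sup>*"
      using red xy by meson
    have "(x, y) \<in> adj H"
      using xy e by (auto simp: adj_def)
    then have "s \<in> component H x" "t \<in> component H x"
      using s t rtrancl_mono[OF adjm] sp
      by (auto simp: component_def intro: converse_rtrancl_into_rtrancl)
    then have "s = t"
      using root[OF xy(2)] s t by blast
    have "sym (adj ?H)"
      by (auto simp: sym_def adj_def insert_commute)
    then have "(x, y) \<in> (adj ?H)\<^sup>*"
      using s t \<open>s = t\<close> by (meson sym_rtrancl symD rtrancl_trans)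
    then show False
      using cycle_through_edge[OF wfH e(1) xy(1) e(2) XH] fo HH by simp
  qed
  with XH pm show ?thesis
    by (auto simp: rooted_edge_sets_def)
qed

text \<open>A spanning subgraph shares vertices and \<open>ends\<close> with \<open>G\<close>, so
  its edge set determines it.\<close>

lemma num_rooted_spanning_forests_eq:
  fixes G :: "('v, 'e) multigraph"
  assumes "wf_multigraph G" "S \<subseteq> verts G"
  shows "num_rooted_spanning_forests G S = card (rooted_edge_sets G S)"
proof -
  have "bij_betw edges (rooted_spanning_forests G S) (rooted_edge_sets G S)"
  proof (rule bij_betw_byWitness[where f' = "\<lambda>X. G\<lparr>edges := X\<rparr>"])
    show "\<forall>H\<in>rooted_spanning_forests G S. G\<lparr>edges := edges H\<rparr> = H"
      by (auto simp: rooted_spanning_forests_def spanning_def subgraph_def)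
    show "edges ` rooted_spanning_forests G S \<subseteq> rooted_edge_sets G S"
      using rooted_spanning_forest_parent_map[OF assms(1)] by blast
    show "(\<lambda>X. G\<lparr>edges := X\<rparr>) ` rooted_edge_sets G S \<subseteq> rooted_spanning_forests G S"
      using parent_map_rooted_spanning_forest[OF assms] by (auto simp: rooted_edge_sets_def)
  qed simp
  then show ?thesis
    unfolding num_rooted_spanning_forests_def by (rule bij_betw_same_card)
qed

section \<open>Contraction of the root set\<close>

text \<open>With a single root, one root per component means that every vertex is joined to
  \<open>s\<close>, which is connectedness.\<close>

lemma spanning_trees_eq_rooted:
  assumes "s \<in> verts G"
  shows "spanning_trees G = rooted_spanning_forests G {s}"
proof -
  have "connected_graph H \<longleftrightarrow> (\<forall>C\<in>components H. \<exists>!t. t \<in> C \<and> t \<in> {s})"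
    if "spanning H G" for H
  proof -
    have V: "verts H = verts G"
      using that by (simp add: spanning_def)
    have sym: "sym ((adj H)\<^sup>*)"
      by (intro sym_rtrancl) (auto simp: sym_def adj_def insert_commute)
    have "(\<forall>C\<in>components H. \<exists>!t. t \<in> C \<and> t \<in> {s}) \<longleftrightarrow> (\<forall>v\<in>verts G. (v, s) \<in> (adj H)\<^sup>*)"
      using assms V by (auto simp: components_def component_def)
    also have "\<dots> \<longleftrightarrow> connected_graph H"
      unfolding connected_graph_def V using assms by (metis empty_iff rtrancl_trans sym symD)
    finally show ?thesis ..
  qed
  then show ?thesis
    by (auto simp: spanning_trees_def rooted_spanning_forests_def)
qed

text \<open>Non-roots of the quotient are the singletons of the non-roots of \<open>G\<close>;
  parent maps are carried across by exchanging \<open>v\<close> and \<open>{v}\<close>.\<close>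

lemma rooted_edge_sets_contract:
  assumes wf: "wf_multigraph G" and S: "S \<noteq> {}"
  shows "rooted_edge_sets (contract G S) {S} = rooted_edge_sets G S"
proof -
  have V: "verts (contract G S) - {S} = (\<lambda>v. {v}) ` (verts G - S)"
    by (auto simp: contract_def vertex_class_def)
  have "X \<in> rooted_edge_sets (contract G S) {S}" if X: "X \<in> rooted_edge_sets G S" for X
  proof -
    obtain p r where p: "parent_map G S p r" "X = p ` (verts G - S)"
      using X by (auto simp: rooted_edge_sets_def)
    define p' where "p' A = p (the_elem A)" for A
    \<comment> \<open>The roots, possibly of different ranks, merge into one vertex. Rank 0 there
      and a shift by one elsewhere keep every parent step descending.\<close>
    define r' where "r' A = (if A = S then 0 else Suc (r (the_elem A)))" for A
    have "parent_map (contract G S) {S} p' r'"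
      unfolding parent_map_def V
    proof clarify
      fix v assume v: "v \<in> verts G" "v \<notin> S"
      then obtain u where u: "p v \<in> edges G" "ends G (p v) = {v, u}" "r u < r v"
        using parent_mapE[OF p(1)] by blast
      \<comment> \<open>The two end classes differ, so the parent edge does not become a loop and
        survives contraction.\<close>
      have "vertex_class S u \<noteq> {v}"
        using u v by (auto simp: vertex_class_def)
      moreover have image: "vertex_class S ` ends G (p v) = {{v}, vertex_class S u}"
        using u v by (simp add: vertex_class_def)
      ultimately have "p' {v} \<in> edges (contract G S)"
        using u by (simp add: p'_def contract_def card_insert_if)
      moreover have "ends (contract G S) (p' {v}) = {{v}, vertex_class S u}"
        using image by (simp add: p'_def contract_def)
      moreover have "r' (vertex_class S u) < r' {v}"
        using u v by (auto simp: r'_def vertex_class_def)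
      ultimately show "p' {v} \<in> edges (contract G S) \<and>
          (\<exists>U. ends (contract G S) (p' {v}) = {{v}, U} \<and> r' U < r' {v})"
        by blast
    qed
    moreover have "X = p' ` (verts (contract G S) - {S})"
      unfolding V image_image p(2) by (simp add: p'_def)
    ultimately show ?thesis
      unfolding rooted_edge_sets_def by blast
  qed
  moreover have "X \<in> rooted_edge_sets G S" if X: "X \<in> rooted_edge_sets (contract G S) {S}" for X
  proof -
    obtain p r where p: "parent_map (contract G S) {S} p r"
        "X = p ` (verts (contract G S) - {S})"
      using X by (auto simp: rooted_edge_sets_def)
    \<comment> \<open>Pulled back along \<open>vertex_class S\<close>, all roots receive the rank of
      the merged vertex.\<close>
    have "parent_map G S (\<lambda>v. p {v}) (\<lambda>v. r (vertex_class S v))"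
      unfolding parent_map_def
    proof
      fix v assume v: "v \<in> verts G - S"
      then have "{v} \<in> verts (contract G S) - {S}"
        using V by blast
      then obtain U where U: "p {v} \<in> edges (contract G S)"
          "ends (contract G S) (p {v}) = {{v}, U}" "r U < r {v}"
        using parent_mapE[OF p(1)] by metis
      let ?e = "p {v}"
      have e: "?e \<in> edges G" "vertex_class S ` ends G ?e = {{v}, U}"
        using U by (auto simp: contract_def)
      obtain x y where xy: "ends G ?e = {x, y}"
        using wf_multigraph_endsE[OF wf e(1)] by metis
      \<comment> \<open>The class \<open>{v}\<close> comes from \<open>v\<close> alone, so the edge
        has \<open>v\<close> itself as an end in \<open>G\<close>.\<close>
      have class_v: "w = v" if "vertex_class S w = {v}" for w
        using that v by (auto simp: vertex_class_def split: if_splits)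
      have "{vertex_class S x, vertex_class S y} = {{v}, U}"
        using e xy by simp
      then obtain u where "ends G ?e = {v, u}" "vertex_class S u = U"
        using class_v xy unfolding doubleton_eq_iff by (metis insert_commute)
      moreover have "vertex_class S v = {v}"
        using v by (simp add: vertex_class_def)
      ultimately show "?e \<in> edges G \<and>
          (\<exists>u. ends G ?e = {v, u} \<and> r (vertex_class S u) < r (vertex_class S v))"
        using U(3) e(1) by metis
    qed
    moreover have "X = (\<lambda>v. p {v}) ` (verts G - S)"
      unfolding p(2) V by (simp add: image_image)
    ultimately show ?thesis
      unfolding rooted_edge_sets_def by blast
  qed
  ultimately show ?thesis
    by blast
qed

lemma num_rooted_spanning_forests_eq_num_spanning_trees_contract:
  assumes "wf_multigraph G" "S \<subseteq> verts G" "S \<noteq> {}"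
  shows "num_rooted_spanning_forests G S = num_spanning_trees (contract G S)"
proof -
  have S: "S \<in> verts (contract G S)"
    using assms by (auto simp: contract_def vertex_class_def)
  then have "num_spanning_trees (contract G S) = num_rooted_spanning_forests (contract G S) {S}"
    by (simp add: num_spanning_trees_def num_rooted_spanning_forests_def spanning_trees_eq_rooted)
  also have "\<dots> = card (rooted_edge_sets G S)"
    using assms S wf_multigraph_contract[OF assms(1)]
    by (simp add: num_rooted_spanning_forests_eq rooted_edge_sets_contract)
  finally show ?thesis
    using assms by (simp add: num_rooted_spanning_forests_eq)
qed

section \<open>Counting words without the factor \<open>Next Prev\<close>\<close>

text \<open>
  Words are indexed by the non-root rim positions and padded with \<open>Hub\<close> elsewhere, so roots never
  take part in the forbidden factor.
\<close>

datatype direction = Hub | Next | Prev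

definition direction_words :: "nat set \<Rightarrow> (nat \<Rightarrow> direction) set" where
  "direction_words A =
     {q. (\<forall>k. k \<notin> A \<longrightarrow> q k = Hub) \<and> (\<forall>k. \<not> (q k = Next \<and> q (Suc k) = Prev))}"

lemma direction_words_empty: "direction_words {} = {\<lambda>_. Hub}"
  by (auto simp: direction_words_def)

text \<open>Position \<open>Suc (Suc k)\<close> carries \<open>Hub\<close>, so a letter written at
  \<open>Suc k\<close> can complete the forbidden factor only as \<open>Prev\<close> after a
  \<open>Next\<close> at \<open>k\<close>.\<close>

lemma direction_words_insert:
  assumes "Suc k \<notin> A" "Suc (Suc k) \<notin> A"
  shows "{q \<in> direction_words (insert (Suc k) A). q (Suc k) = x} =
    (\<lambda>q. q(Suc k := x)) ` {q \<in> direction_words A. x = Prev \<longrightarrow> q k \<noteq> Next}" (is "?L = ?f ` ?R")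
proof
  show "?L \<subseteq> ?f ` ?R"
  proof
    fix q assume q: "q \<in> ?L"
    then have "q(Suc k := Hub) \<in> ?R"
      by (auto simp: direction_words_def)
    moreover have "q = ?f (q(Suc k := Hub))"
      using q by auto
    ultimately show "q \<in> ?f ` ?R"
      by blast
  qed
  show "?f ` ?R \<subseteq> ?L"
    using assms by (auto simp: direction_words_def split: if_splits)
qed

lemma card_direction_words_insert:
  assumes "Suc k \<notin> A" "Suc (Suc k) \<notin> A"
  shows "card {q \<in> direction_words (insert (Suc k) A). q (Suc k) = x} =
    card {q \<in> direction_words A. x = Prev \<longrightarrow> q k \<noteq> Next}"
proof -
  have "inj_on (\<lambda>q. q(Suc k := x)) {q \<in> direction_words A. x = Prev \<longrightarrow> q k \<noteq> Next}"
  proof (rule inj_onI)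
    fix q q' assume "q \<in> {q \<in> direction_words A. x = Prev \<longrightarrow> q k \<noteq> Next}"
      "q' \<in> {q \<in> direction_words A. x = Prev \<longrightarrow> q k \<noteq> Next}" and eq: "q(Suc k := x) = q'(Suc k := x)"
    \<comment> \<open>Both words carry \<open>Hub\<close> at \<open>Suc k\<close>, so overwriting
      that position loses nothing.\<close>
    then have "q (Suc k) = q' (Suc k)"
      using assms by (simp add: direction_words_def)
    with eq show "q = q'"
      by (metis fun_upd_triv fun_upd_upd)
  qed
  then show ?thesis
    unfolding direction_words_insert[OF assms] by (rule card_image)
qed

text \<open>Words not ending in \<open>Next\<close> are counted alongside, as exactly these may be
  followed by \<open>Prev\<close>. From \<open>t\<close> words in all and \<open>s\<close> of these,
  one more letter gives \<open>t + s\<close> not ending in \<open>Next\<close> and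
  \<open>2 * t + s\<close> in all: two Fibonacci steps. For \<open>n = 0\<close>, position
  \<open>m + n\<close> lies outside the interval and carries \<open>Hub\<close>.\<close>

lemma card_direction_words_interval:
  "finite (direction_words {m<..m + n}) \<and>
   card (direction_words {m<..m + n}) = fib (2 * n + 2) \<and>
   card {q \<in> direction_words {m<..m + n}. q (m + n) \<noteq> Next} = fib (2 * n + 1)"
proof (induction n)
  case 0
  have "{q. q = (\<lambda>_. Hub) \<and> q m \<noteq> Next} = {\<lambda>_. Hub}"
    by auto
  then show ?case
    by (simp add: direction_words_empty)
next
  case (Suc n)
  define A where "A = {m<..m + n}"
  define k where "k = m + n"
  have ins: "{m<..m + Suc n} = insert (Suc k) A" and A: "Suc k \<notin> A" "Suc (Suc k) \<notin> A"
    by (auto simp: A_def k_def)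
  note IH = Suc.IH[folded A_def, folded k_def]
  let ?W = "\<lambda>x. {q \<in> direction_words (insert (Suc k) A). q (Suc k) = x}"
  have fin: "finite (?W x)" for x
    unfolding direction_words_insert[OF A] using IH by simp
  have card: "card (?W Hub) = fib (2 * n + 2)" "card (?W Next) = fib (2 * n + 2)"
      "card (?W Prev) = fib (2 * n + 1)"
    using IH by (simp_all add: card_direction_words_insert[OF A])
  have not_Next: "{q \<in> direction_words (insert (Suc k) A). q (Suc k) \<noteq> Next} = ?W Hub \<union> ?W Prev"
    by (auto intro: direction.exhaust)
  have all: "direction_words (insert (Suc k) A) = (?W Hub \<union> ?W Prev) \<union> ?W Next"
    by (auto intro: direction.exhaust)
  have 1: "card (?W Hub \<union> ?W Prev) = fib (2 * n + 3)"
    using card by (subst card_Un_disjoint[OF fin fin]) (auto simp: numeral_3_eq_3)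
  have "card ((?W Hub \<union> ?W Prev) \<union> ?W Next) = fib (2 * n + 4)"
    using card 1 fin
    by (subst card_Un_disjoint) (auto simp: eval_nat_numeral)
  then have 2: "card (direction_words (insert (Suc k) A)) = fib (2 * n + 4)"
    by (subst all)
  have 3: "finite (direction_words (insert (Suc k) A))"
    by (subst all) (intro finite_UnI fin)
  have "m + Suc n = Suc k"
    by (simp add: k_def)
  then show ?case
    unfolding ins using 1 2 3 not_Next by (simp add: eval_nat_numeral)
qed

text \<open>Position \<open>d\<close> lies in neither set, so every word carries \<open>Hub\<close>
  there and no forbidden factor crosses it.\<close>

lemma card_direction_words_Un:
  assumes A: "A \<subseteq> {..<d}" and B: "B \<subseteq> {d<..}"
  shows "card (direction_words (A \<union> B)) = card (direction_words A) * card (direction_words B)"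
proof -
  let ?f = "\<lambda>q. (\<lambda>k. if k < d then q k else Hub, \<lambda>k. if k < d then Hub else q k)"
  let ?g = "\<lambda>(q, q') k. if k < d then q k else q' k :: direction"
  have notin: "k < d \<Longrightarrow> k \<notin> B" "\<not> k < d \<Longrightarrow> k \<notin> A" for k
    using A B by auto
  have "bij_betw ?f (direction_words (A \<union> B)) (direction_words A \<times> direction_words B)"
  proof (rule bij_betw_byWitness[where f' = ?g])
    show "\<forall>q\<in>direction_words (A \<union> B). ?g (?f q) = q"
      by auto
    show "\<forall>z\<in>direction_words A \<times> direction_words B. ?f (?g z) = z"
    proof
      fix z assume "z \<in> direction_words A \<times> direction_words B"
      then obtain q q' where z: "z = (q, q')" and q: "q \<in> direction_words A"
          and q': "q' \<in> direction_words B"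
        by blast
      have "q k = Hub" if "\<not> k < d" for k
        using A q that by (auto simp: direction_words_def)
      moreover have "q' k = Hub" if "k < d" for k
        using B q' that by (auto simp: direction_words_def)
      ultimately show "?f (?g z) = z"
        by (auto simp: z)
    qed
    show "?f ` direction_words (A \<union> B) \<subseteq> direction_words A \<times> direction_words B"
      by (auto simp: direction_words_def notin split: if_splits)
    show "?g ` (direction_words A \<times> direction_words B) \<subseteq> direction_words (A \<union> B)"
    proof (rule image_subsetI)
      fix z assume "z \<in> direction_words A \<times> direction_words B"
      then obtain q q' where z: "z = (q, q')" and q: "q \<in> direction_words A"
          and q': "q' \<in> direction_words B"
        by blast
      \<comment> \<open>A factor of the glued word mixes \<open>q\<close> and \<open>q'\<close> only
        at \<open>Suc k = d\<close>, where its second letter is this \<open>Hub\<close>.\<close>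
      have "q' d = Hub"
        using q' B by (auto simp: direction_words_def)
      then have "\<not> (?g (q, q') k = Next \<and> ?g (q, q') (Suc k) = Prev)" for k
        using q q' by (cases "Suc k = d") (auto simp: direction_words_def)
      moreover have "?g (q, q') k = Hub" if "k \<notin> A \<union> B" for k
        using q q' that by (auto simp: direction_words_def)
      ultimately show "?g z \<in> direction_words (A \<union> B)"
        unfolding z by (simp add: direction_words_def)
    qed
  qed
  then show ?thesis
    by (simp add: bij_betw_same_card card_cartesian_product)
qed

section \<open>The wheel in rotated rim coordinates\<close>

text \<open>
  The rim is renumbered cyclically so that position 0 (equivalently \<open>N\<close>) is a root; the free
  positions then form linear, not cyclic, intervals.
\<close>

definition rim :: "nat \<Rightarrow> nat \<Rightarrow> nat \<Rightarrow> wheel_vertex" where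
  "rim N c k = Rim ((c + k) mod N + 1)"

text \<open>At \<open>k = N - 1\<close>, \<open>Next\<close> wraps to position 0; for
  \<open>0 < k\<close>, \<open>Prev\<close> is the true predecessor despite truncated
  subtraction.\<close>

fun direction_edge :: "nat \<Rightarrow> nat \<Rightarrow> nat \<Rightarrow> direction \<Rightarrow> wheel_vertex set" where
  "direction_edge N c k Hub = {rim N c k, Center}"
| "direction_edge N c k Next = {rim N c k, rim N c (Suc k)}"
| "direction_edge N c k Prev = {rim N c k, rim N c (k - 1)}"

lemma rim_neq_Center [simp]: "rim N c k \<noteq> Center" "Center \<noteq> rim N c k"
  by (simp_all add: rim_def)

lemma rim_eq_iff: "rim N c j = rim N c k \<longleftrightarrow> j mod N = k mod N"
proof -
  have "[c + j = c + k] (mod N) \<longleftrightarrow> [j = k] (mod N)"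
    by (rule cong_add_lcancel_nat)
  then show ?thesis
    by (simp add: rim_def cong_def)
qed

lemma inj_on_rim: "inj_on (rim N c) {..<N}"
  by (auto simp: inj_on_def rim_eq_iff)

text \<open>An injection between two sets of size \<open>N\<close> is onto, so any offset
  \<open>c\<close> renumbers the whole rim.\<close>

lemma wheel_indices:
  fixes N c :: nat
  assumes "N > 0"
  shows "{1..N} = (\<lambda>k. (c + k) mod N + 1) ` {..<N}"
proof -
  have "inj_on (\<lambda>k. (c + k) mod N + 1) {..<N}"
    using inj_on_rim[of N c] unfolding inj_on_def rim_def by blast
  then have "card ((\<lambda>k. (c + k) mod N + 1) ` {..<N}) = card {1..N}"
    by (simp add: card_image)
  moreover have "(\<lambda>k. (c + k) mod N + 1) ` {..<N} \<subseteq> {1..N}"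
  proof clarify
    fix k
    have "(c + k) mod N < N"
      using assms by simp
    then show "(c + k) mod N + 1 \<in> {1..N}"
      by simp
  qed
  ultimately show ?thesis
    by (intro card_subset_eq[symmetric]) auto
qed

lemma verts_wheel_rim: "N > 0 \<Longrightarrow> verts (wheel N) = insert Center (rim N c ` {..<N})"
  by (simp only: wheel_def wheel_indices[of N c] image_image rim_def[abs_def] multigraph.simps)

lemma edges_wheel_rim:
  assumes "N > 0"
  shows "edges (wheel N) = (\<lambda>k. {rim N c k, rim N c (Suc k)}) ` {..<N} \<union>
    (\<lambda>k. {Center, rim N c k}) ` {..<N}"
proof -
  have "rim N c (Suc k) = Rim (((c + k) mod N + 1) mod N + 1)" for k
    by (simp add: rim_def mod_Suc_eq)
  then show ?thesis
    unfolding wheel_def wheel_indices[OF assms, of c] image_image multigraph.simps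
    by (simp only: rim_def)
qed

lemma direction_edge_in_wheel:
  assumes "0 < k" "k < N"
  shows "direction_edge N c k x \<in> edges (wheel N)"
proof (cases x)
  case Prev
  have "{rim N c (k - 1), rim N c (Suc (k - 1))} \<in> edges (wheel N)"
    using assms by (subst edges_wheel_rim) auto
  then show ?thesis
    using assms Prev by (simp add: insert_commute)
qed (use assms in \<open>auto simp: edges_wheel_rim[of N c]\<close>)

text \<open>A rim edge starting at \<open>j\<close> meets position \<open>k\<close> only for
  \<open>j = k\<close> or \<open>Suc j = k\<close>, as \<open>0 < k\<close> excludes the wrap from
  \<open>N - 1\<close> to 0.\<close>

lemma wheel_edge_direction:
  assumes e: "e \<in> edges (wheel N)" "rim N c k \<in> e" and k: "0 < k" "k < N"
  obtains x where "e = direction_edge N c k x"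
proof -
  have "N > 0"
    using k by simp
  then consider j where "j < N" "e = {rim N c j, rim N c (Suc j)}"
    | j where "j < N" "e = {Center, rim N c j}"
    using e(1) by (auto simp: edges_wheel_rim[of N c])
  then show ?thesis
  proof cases
    case 1
    show ?thesis
    proof (cases "j = k")
      case True
      then show ?thesis
        using that[of Next] 1 by simp
    next
      case False
      then have "rim N c k = rim N c (Suc j)"
        using e(2) 1 k by (auto simp: rim_eq_iff)
      then have "k = Suc j"
        using 1 k by (simp add: rim_eq_iff mod_Suc split: if_splits)
      then show ?thesis
        using that[of Prev] 1 by (simp add: insert_commute)
    qed
  next
    case 2
    then have "j = k"
      using e(2) k by (auto simp: rim_eq_iff)
    then show ?thesis
      using that[of Hub] 2 by (simp add: insert_commute)
  qed
qed

text \<open>With \<open>N \<ge> 3\<close> the predecessor and successor of a rim vertex differ; for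
  \<open>N = 2\<close>, \<open>Next\<close> and \<open>Prev\<close> would name the same
  edge.\<close>

lemma direction_edge_inj:
  assumes "N \<ge> 3" "0 < k" "k < N" "direction_edge N c k x = direction_edge N c k y"
  shows "x = y"
proof -
  have "(k - 1) mod N \<noteq> Suc k mod N"
    using assms by (auto simp: mod_Suc)
  with assms(4) show ?thesis
    by (cases x; cases y) (auto simp: doubleton_eq_iff rim_eq_iff)
qed

text \<open>The letter at \<open>k\<close> selects the parent edge of rim position \<open>k\<close>.
  Words without \<open>Next Prev\<close> admit a decreasing rank; conversely, that factor would make
  one edge the parent edge of both its ends.\<close>

lemma bij_betw_direction_words:
  assumes N: "N \<ge> 3" and d: "0 < d" "d < N"
  defines "A \<equiv> {1..<N} - {d}"
  shows "bij_betw (\<lambda>q. (\<lambda>k. direction_edge N c k (q k)) ` A) (direction_words A)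
    (rooted_edge_sets (wheel N) {Center, rim N c 0, rim N c d})"
proof -
  let ?S = "{Center, rim N c 0, rim N c d}"
  let ?x = "rim N c"
  let ?X = "\<lambda>q. (\<lambda>k. direction_edge N c k (q k)) ` A"
  define index where "index = the_inv_into {..<N} ?x"
  have index: "index (?x k) = k" if "k < N" for k
    using that inj_on_rim by (simp add: index_def the_inv_into_f_f)
  have AN: "0 < k" "k < N" if "k \<in> A" for k
    using that by (auto simp: A_def)
  have V: "verts (wheel N) - ?S = ?x ` A"
    using N d by (auto simp: verts_wheel_rim[of N c] A_def rim_eq_iff)
  have wheel_ends: "ends (wheel N) e = e" for e
    by (simp add: wheel_def)
  have xN: "?x N = ?x 0"
    by (simp add: rim_eq_iff)
  \<comment> \<open>A run of \<open>Prev\<close> leads down to a root or a \<open>Hub\<close>, a run of \<open>Next\<close> leads up to one,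
    as \<open>Next Prev\<close> does not occur.\<close>
  define rank where "rank q v = (case v of Center \<Rightarrow> 0 | Rim _ \<Rightarrow> if index v \<notin> A then 0
     else (case q (index v) of Hub \<Rightarrow> 1 | Prev \<Rightarrow> index v + 1 | Next \<Rightarrow> N + 1 - index v))"
    for q v
  have rank_Center: "rank q Center = 0" for q
    by (simp add: rank_def)
  have rank_rim: "rank q (?x k) = (if k \<notin> A then 0 else
     (case q k of Hub \<Rightarrow> 1 | Prev \<Rightarrow> k + 1 | Next \<Rightarrow> N + 1 - k))" if "k < N" for q k
  proof -
    obtain m where "?x k = Rim m"
      by (simp add: rim_def)
    then show ?thesis
      using index[OF that] by (simp add: rank_def split: direction.split)
  qed
  have rank_N: "rank q (?x N) = 0" for q
    using rank_rim[of 0 q] N xN by (simp add: A_def)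
  define parent where "parent q v = direction_edge N c (index v) (q (index v))" for q v
  have parent_map: "parent_map (wheel N) ?S (parent q) (rank q)" if q: "q \<in> direction_words A" for q
    unfolding parent_map_def V
  proof clarify
    fix k assume k: "k \<in> A"
    note kN = AN[OF k]
    have NP: "\<not> (q j = Next \<and> q (Suc j) = Prev)" for j
      using q by (auto simp: direction_words_def)
    have "\<exists>u. direction_edge N c k (q k) = {?x k, u} \<and> rank q u < rank q (?x k)"
    proof (cases "q k")
      case Hub
      then show ?thesis
        using k kN by (auto simp: rank_Center rank_rim)
    next
      case Prev
      have "q (k - 1) \<noteq> Next"
        using NP[of "k - 1"] Prev kN by simp
      \<comment> \<open>Position \<open>k - 1\<close> has rank 0 at a root, 1 at \<open>Hub\<close>
        and \<open>k\<close> at \<open>Prev\<close>, all below \<open>k + 1\<close>.\<close>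
      then have "rank q (?x (k - 1)) < rank q (?x k)"
        using k kN Prev rank_rim[of k q] rank_rim[of "k - 1" q] by (auto split: direction.splits)
      with Prev show ?thesis
        by auto
    next
      case Next
      have "q (Suc k) \<noteq> Prev"
        using NP[of k] Next by simp
      \<comment> \<open>Position \<open>Suc k\<close> has rank 0 at a root, including position
        \<open>N\<close>, 1 at \<open>Hub\<close> and \<open>N - k\<close> at \<open>Next\<close>,
        all below \<open>N + 1 - k\<close>.\<close>
      then have "rank q (?x (Suc k)) < rank q (?x k)"
        using k kN Next rank_rim[of k q] rank_rim[of "Suc k" q] rank_N[of q]
        by (cases "Suc k = N") (auto split: direction.splits)
      with Next show ?thesis
        by auto
    qed
    then show "parent q (?x k) \<in> edges (wheel N) \<and>
       (\<exists>u. ends (wheel N) (parent q (?x k)) = {?x k, u} \<and> rank q u < rank q (?x k))"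
      using kN by (simp add: parent_def index wheel_ends direction_edge_in_wheel)
  qed
  have parent_image: "?X q = parent q ` (verts (wheel N) - ?S)" for q
    unfolding V image_image parent_def using AN by (intro image_cong) (auto simp: index)
  show ?thesis
  proof (rule bij_betw_imageI)
    show "inj_on ?X (direction_words A)"
    proof (rule inj_onI, rule ext)
      fix q q' k assume q: "q \<in> direction_words A" "q' \<in> direction_words A" and eq: "?X q = ?X q'"
      show "q k = q' k"
      proof (cases "k \<in> A")
        case True
        then have "parent q (?x k) = parent q' (?x k)"
          using V eq parent_image
          by (intro parent_map_unique[OF parent_map[OF q(1)] parent_map[OF q(2)]]) auto
        then show ?thesis
          using direction_edge_inj[OF N] AN[OF True] by (simp add: parent_def index)
      qed (use q in \<open>auto simp: direction_words_def\<close>)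
    qed
    show "?X ` direction_words A = rooted_edge_sets (wheel N) ?S"
    proof
      show "?X ` direction_words A \<subseteq> rooted_edge_sets (wheel N) ?S"
        unfolding rooted_edge_sets_def using parent_image parent_map by blast
      show "rooted_edge_sets (wheel N) ?S \<subseteq> ?X ` direction_words A"
      proof
        fix X assume "X \<in> rooted_edge_sets (wheel N) ?S"
        then obtain p r where p: "parent_map (wheel N) ?S p r" and X: "X = p ` ?x ` A"
          unfolding rooted_edge_sets_def V by blast
        have up: "\<exists>u. p (?x k) = {?x k, u} \<and> r u < r (?x k)"
          and in_wheel: "p (?x k) \<in> edges (wheel N)" if "k \<in> A" for k
          using parent_mapE[OF p, unfolded V wheel_ends, OF imageI[OF that]] by metis+
        have "\<exists>x. p (?x k) = direction_edge N c k x" if k: "k \<in> A" for k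
          using wheel_edge_direction[OF in_wheel[OF k] _ AN[OF k]] up[OF k] by blast
        then obtain q0 where q0: "\<And>k. k \<in> A \<Longrightarrow> p (?x k) = direction_edge N c k (q0 k)"
          by metis
        define q where "q k = (if k \<in> A then q0 k else Hub)" for k
        have q: "p (?x k) = direction_edge N c k (q k)" if "k \<in> A" for k
          using q0 that by (simp add: q_def)
        have "\<not> (q k = Next \<and> q (Suc k) = Prev)" for k
        proof
          assume *: "q k = Next \<and> q (Suc k) = Prev"
          then have kA: "k \<in> A" "Suc k \<in> A"
            by (auto simp: q_def split: if_splits)
          have "{?x k, ?x (Suc k)} = p (?x k)" "{?x k, ?x (Suc k)} = p (?x (Suc k))"
            using * q[OF kA(1)] q[OF kA(2)] by auto
          then show False
            using up[OF kA(1)] up[OF kA(2)] by (auto simp: doubleton_eq_iff)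
        qed
        then have "q \<in> direction_words A"
          by (auto simp: direction_words_def q_def)
        moreover have "X = ?X q"
          unfolding X image_image using q by (intro image_cong) auto
        ultimately show "X \<in> ?X ` direction_words A"
          by blast
      qed
    qed
  qed
qed

section \<open>The product over the two arcs between the rim roots\<close>

theorem corollary3p5:
  fixes N a b d :: nat
  assumes "N \<ge> 3"
    and "1 \<le> a" and "a < b" and "b \<le> N"
    and "d = b - a"
  shows "num_rooted_spanning_forests (wheel N) {Center, Rim a, Rim b}
           = num_spanning_trees (contract (wheel N) {Center, Rim a, Rim b})
       \<and> num_spanning_trees (contract (wheel N) {Center, Rim a, Rim b})
           = fib (2 * d) * fib (2 * (N - d))"
proof -
  let ?S = "{Center, Rim a, Rim b}"
  have d: "0 < d" "d < N"
    using assms by auto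
  \<comment> \<open>The offset \<open>a - 1\<close> cancels the \<open>+ 1\<close> in
    \<open>rim\<close>, placing \<open>Rim a\<close> at position 0 and \<open>Rim b\<close> at
    position \<open>d\<close>.\<close>
  have "Rim a = rim N (a - 1) 0" "Rim b = rim N (a - 1) d"
    using assms by (auto simp: rim_def)
  then have "card (rooted_edge_sets (wheel N) ?S) = card (direction_words ({1..<N} - {d}))"
    using bij_betw_same_card[OF bij_betw_direction_words[OF assms(1) d, of "a - 1"]] by simp
  \<comment> \<open>The root at \<open>d\<close> splits the free positions into runs of
    \<open>d - 1\<close> and \<open>N - d - 1\<close>, written as \<open>{m<..m + n}\<close> to
    match the interval count.\<close>
  also have "{1..<N} - {d} = {0<..0 + (d - 1)} \<union> {d<..d + (N - d - 1)}"
    using d by auto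
  also have "card (direction_words \<dots>) =
      card (direction_words {0<..0 + (d - 1)}) * card (direction_words {d<..d + (N - d - 1)})"
    using d by (intro card_direction_words_Un[where d = d]) auto
  also have "\<dots> = fib (2 * (d - 1) + 2) * fib (2 * (N - d - 1) + 2)"
    by (simp only: card_direction_words_interval)
  also have "2 * (d - 1) + 2 = 2 * d"
    using d by simp
  also have "2 * (N - d - 1) + 2 = 2 * (N - d)"
    using d by simp
  finally have card: "card (rooted_edge_sets (wheel N) ?S) = fib (2 * d) * fib (2 * (N - d))" .
  have S: "?S \<subseteq> verts (wheel N)"
    using assms by (auto simp: wheel_def)
  show ?thesis
    using num_rooted_spanning_forests_eq_num_spanning_trees_contract[OF wf_multigraph_wheel S]
      num_rooted_spanning_forests_eq[OF wf_multigraph_wheel S] card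
    by simp
qed

end
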